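(* Let $(R,\preceq)$ be a quasi-ordered ring. Then its support $E_0=\{x\in R: x\sim 0\}$ is a prime ideal of $R$.
   Context: For a reflexive and transitive binary relation $\preceq$, write $a\sim b$ for ($a\preceq b$ and $b\preceq a$), and $a\prec b$ for ($a\preceq b$ and not $b\preceq a$). Quasi-ordered ring: a pair $(R,\preceq)$ where $R$ is a commutative ring with $1$ and $\preceq$ is a binary, reflexive, transitive and total relation on $R$ such that for all $x,y,z\in R$: (QR1) $0\prec 1$; (QR2) $xy\preceq 0\Rightarrow x\preceq 0$ or $y\preceq 0$; (QR3) $x\preceq y$ and $0\preceq z\Rightarrow xz\preceq yz$; (QR4) $x\preceq y$ and $z\nsim y\Rightarrow x+z\preceq y+z$; (QR5) if $0\prec z$, then $xz\preceq yz\Rightarrow x\preceq y$. *)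

theory Defs
  imports "HOL-Algebra.Ideal"
begin

definition quasi_equiv :: "('a \<Rightarrow> 'a \<Rightarrow> bool) \<Rightarrow> 'a \<Rightarrow> 'a \<Rightarrow> bool" where
  "quasi_equiv qle a b \<longleftrightarrow> qle a b \<and> qle b a"

definition quasi_less :: "('a \<Rightarrow> 'a \<Rightarrow> bool) \<Rightarrow> 'a \<Rightarrow> 'a \<Rightarrow> bool" where
  "quasi_less qle a b \<longleftrightarrow> qle a b \<and> \<not> qle b a"

text \<open>
  The relation lives on the carrier of the ring; its values outside the carrier are irrelevant.
  The library's totality only concerns distinct elements, which together with reflexivity
  yields totality for all pairs.
\<close>

locale quasi_ordered_ring = cring R for R (structure) +
  fixes qle :: "'a \<Rightarrow> 'a \<Rightarrow> bool" (infix \<open>\<preceq>\<close> 50)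
  assumes reflexive: "reflp_on (carrier R) (\<preceq>)"
    and transitive: "transp_on (carrier R) (\<preceq>)"
    and total_rel: "totalp_on (carrier R) (\<preceq>)"
    and QR1: "quasi_less (\<preceq>) \<zero> \<one>"
    and QR2: "\<lbrakk>x \<in> carrier R; y \<in> carrier R; x \<otimes> y \<preceq> \<zero>\<rbrakk> \<Longrightarrow> x \<preceq> \<zero> \<or> y \<preceq> \<zero>"
    and QR3: "\<lbrakk>x \<in> carrier R; y \<in> carrier R; z \<in> carrier R; x \<preceq> y; \<zero> \<preceq> z\<rbrakk>
      \<Longrightarrow> x \<otimes> z \<preceq> y \<otimes> z"
    and QR4: "\<lbrakk>x \<in> carrier R; y \<in> carrier R; z \<in> carrier R; x \<preceq> y; \<not> quasi_equiv (\<preceq>) z y\<rbrakk>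
      \<Longrightarrow> x \<oplus> z \<preceq> y \<oplus> z"
    and QR5: "\<lbrakk>x \<in> carrier R; y \<in> carrier R; z \<in> carrier R; quasi_less (\<preceq>) \<zero> z; x \<otimes> z \<preceq> y \<otimes> z\<rbrakk>
      \<Longrightarrow> x \<preceq> y"

definition quasi_support :: "('a, 'm) ring_scheme \<Rightarrow> ('a \<Rightarrow> 'a \<Rightarrow> bool) \<Rightarrow> 'a set" where
  "quasi_support R qle = {x \<in> carrier R. quasi_equiv qle x \<zero>\<^bsub>R\<^esub>}"

end

theory Submission
  imports Defs
begin

text \<open>
  QR4 shows that negation maps non-positive elements to non-negative ones and preserves the
  support. So every element is non-negative up to a sign that is invisible to the support: QR3
  then gives the ideal absorption law and QR2 gives primality. For a sum s of two support
  elements x and y, shifting \<open>-y \<sim> 0\<close> by s, which QR4 permits unless \<open>s \<sim> 0\<close>,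
  yields \<open>x \<sim> s\<close>.
\<close>

context quasi_ordered_ring
begin

abbreviation supp :: "'a set" where
  "supp \<equiv> quasi_support R (\<preceq>)"

lemma in_supp_iff: "x \<in> supp \<longleftrightarrow> x \<in> carrier R \<and> x \<preceq> \<zero> \<and> \<zero> \<preceq> x"
  by (auto simp: quasi_support_def quasi_equiv_def)

lemma qle_refl: "x \<in> carrier R \<Longrightarrow> x \<preceq> x"
  using reflexive by (rule reflp_onD)

lemma qle_trans:
  "\<lbrakk>x \<preceq> y; y \<preceq> z; x \<in> carrier R; y \<in> carrier R; z \<in> carrier R\<rbrakk> \<Longrightarrow> x \<preceq> z"
  using transp_onD[OF transitive] by blast

lemma qle_total: "\<lbrakk>x \<in> carrier R; y \<in> carrier R\<rbrakk> \<Longrightarrow> x \<preceq> y \<or> y \<preceq> x"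
  using totalp_onD[OF total_rel] qle_refl by metis

lemma zero_in_supp: "\<zero> \<in> supp"
  by (simp add: in_supp_iff qle_refl)

lemma one_notin_supp: "\<one> \<notin> supp"
  using QR1 by (simp add: in_supp_iff quasi_less_def)

lemma qequiv_supp:
  assumes "z \<in> carrier R" "y \<in> supp" "quasi_equiv (\<preceq>) z y"
  shows "z \<in> supp"
  using assms unfolding in_supp_iff quasi_equiv_def by (blast intro: qle_trans)

text \<open>When y is in the support, anything equivalent to y lies there too, so the side condition
  of QR4 can be replaced by \<open>z \<notin> supp\<close>.\<close>

lemma qle_add_right:
  assumes "x \<in> carrier R" "y \<in> supp" "z \<in> carrier R" "z \<notin> supp" "x \<preceq> y"
  shows "x \<oplus> z \<preceq> y \<oplus> z"
proof -
  have "\<not> quasi_equiv (\<preceq>) z y"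
    using assms qequiv_supp by blast
  with assms show ?thesis
    by (simp add: in_supp_iff QR4)
qed

text \<open>Add \<open>\<ominus> x\<close> to both sides. This is allowed unless
  \<open>\<ominus> x\<close> is in the support, and then the claim is immediate.\<close>

lemma uminus_nonneg:
  assumes "x \<in> carrier R" "x \<preceq> \<zero>"
  shows "\<zero> \<preceq> \<ominus> x"
proof (cases "\<ominus> x \<in> supp")
  case False
  then show ?thesis
    using qle_add_right[of x \<zero> "\<ominus> x"] assms zero_in_supp by (simp add: r_neg)
qed (simp add: in_supp_iff)

text \<open>One inequality is \<open>uminus_nonneg\<close>. The other comes from adding
  \<open>\<ominus> x\<close> to \<open>\<zero> \<preceq> x\<close>, which needs
  \<open>\<ominus> x \<notin> supp\<close>; hence the proof by contradiction.\<close>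

lemma uminus_in_supp:
  assumes "x \<in> supp"
  shows "\<ominus> x \<in> supp"
proof (rule ccontr)
  have x: "x \<in> carrier R" "x \<preceq> \<zero>" "\<zero> \<preceq> x"
    using assms by (auto simp: in_supp_iff)
  assume notin: "\<ominus> x \<notin> supp"
  then have "\<ominus> x \<preceq> \<zero>"
    using qle_add_right[of \<zero> x "\<ominus> x"] assms x by (simp add: r_neg)
  with uminus_nonneg[OF x(1,2)] x(1) notin show False
    by (simp add: in_supp_iff)
qed

lemma uminus_in_supp_iff: "x \<in> carrier R \<Longrightarrow> \<ominus> x \<in> supp \<longleftrightarrow> x \<in> supp"
  using uminus_in_supp[of x] uminus_in_supp[of "\<ominus> x"] by auto

lemma add_in_supp:
  assumes "x \<in> supp" "y \<in> supp"
  shows "x \<oplus> y \<in> supp"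
proof (rule ccontr)
  assume notin: "x \<oplus> y \<notin> supp"
  have x: "x \<in> carrier R" and y: "y \<in> carrier R" and ny: "\<ominus> y \<in> supp"
    using assms uminus_in_supp by (auto simp: in_supp_iff)
  \<comment> \<open>Hence shifting the two sides of \<open>\<ominus> y \<preceq> \<zero>\<close>, or
    of its converse, by \<open>x \<oplus> y\<close> compares x with
    \<open>x \<oplus> y\<close>.\<close>
  have eq: "\<ominus> y \<oplus> (x \<oplus> y) = x"
    using x y by (simp add: a_lcomm[of "\<ominus> y"] l_neg)
  have "x \<preceq> x \<oplus> y"
    using qle_add_right[of "\<ominus> y" \<zero> "x \<oplus> y"] zero_in_supp notin x y ny eq
    by (simp add: in_supp_iff)
  moreover have "x \<oplus> y \<preceq> x"
    using qle_add_right[of \<zero> "\<ominus> y" "x \<oplus> y"] notin x y ny eq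
    by (simp add: in_supp_iff)
  ultimately show False
    using qequiv_supp[of "x \<oplus> y" x] assms notin x y by (simp add: quasi_equiv_def)
qed

text \<open>By totality, if x itself is not non-negative then \<open>x \<preceq> \<zero>\<close>,
  and \<open>uminus_nonneg\<close> applies.\<close>

lemma nonneg_up_to_sign:
  assumes "x \<in> carrier R"
  obtains y where "y \<in> {x, \<ominus> x}" "\<zero> \<preceq> y"
  using assms uminus_nonneg qle_total[of x \<zero>] by auto

lemma mult_in_supp:
  assumes "x \<in> supp" "r \<in> carrier R"
  shows "x \<otimes> r \<in> supp"
proof -
  obtain s where s: "s \<in> {r, \<ominus> r}" "\<zero> \<preceq> s"
    using nonneg_up_to_sign assms(2) .
  have x: "x \<in> carrier R" "x \<preceq> \<zero>" "\<zero> \<preceq> x"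
    using assms by (auto simp: in_supp_iff)
  have "s \<in> carrier R"
    using s assms by auto
  \<comment> \<open>QR3 multiplies both \<open>x \<preceq> \<zero>\<close> and
    \<open>\<zero> \<preceq> x\<close> by the non-negative s.\<close>
  then have "x \<otimes> s \<in> supp"
    using QR3[of x \<zero> s] QR3[of \<zero> x s] x s by (simp add: in_supp_iff)
  then show ?thesis
    using s x assms by (auto simp: r_minus uminus_in_supp_iff)
qed

lemma prime_supp:
  assumes "x \<in> carrier R" "y \<in> carrier R" "x \<otimes> y \<in> supp"
  shows "x \<in> supp \<or> y \<in> supp"
proof -
  obtain u where u: "u \<in> {x, \<ominus> x}" "\<zero> \<preceq> u"
    using nonneg_up_to_sign assms(1) .
  obtain v where v: "v \<in> {y, \<ominus> y}" "\<zero> \<preceq> v"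
    using nonneg_up_to_sign assms(2) .
  have carr: "u \<in> carrier R" "v \<in> carrier R"
    using u v assms by auto
  \<comment> \<open>This product equals \<open>x \<otimes> y\<close> up to sign.\<close>
  have "u \<otimes> v \<in> supp"
    using u v assms by (auto simp: r_minus l_minus uminus_in_supp_iff)
  then have "u \<preceq> \<zero> \<or> v \<preceq> \<zero>"
    using QR2 carr by (simp add: in_supp_iff)
  \<comment> \<open>QR2 bounds a factor only from above; the choice of signs supplies the bound from
    below.\<close>
  then have "u \<in> supp \<or> v \<in> supp"
    using u v carr by (auto simp: in_supp_iff)
  then show ?thesis
    using u v assms by (auto simp: uminus_in_supp_iff)
qed

lemma ideal_supp: "ideal supp R"
proof (rule idealI)
  show "ring R" ..
  show "subgroup supp (add_monoid R)"
  proof (rule add.subgroupI)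
    show "supp \<subseteq> carrier R"
      by (auto simp: in_supp_iff)
    show "supp \<noteq> {}"
      using zero_in_supp by auto
  qed (simp_all add: add_in_supp uminus_in_supp flip: a_inv_def)
  show "x \<otimes> a \<in> supp" "a \<otimes> x \<in> supp" if "a \<in> supp" "x \<in> carrier R" for a x
    using mult_in_supp[OF that] that by (auto simp: in_supp_iff m_comm)
qed

lemma primeideal_supp: "primeideal supp R"
proof (rule primeidealI)
  show "ideal supp R" by (rule ideal_supp)
  show "cring R" ..
  \<comment> \<open>By QR1, \<one> is outside the support.\<close>
  show "carrier R \<noteq> supp"
    using one_notin_supp by auto
qed (rule prime_supp)

end

theorem proposition3p8:
  fixes R :: "('a, 'm) ring_scheme" and qle :: "'a \<Rightarrow> 'a \<Rightarrow> bool"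
  assumes "quasi_ordered_ring R qle"
  shows "primeideal (quasi_support R qle) R"
  using assms by (rule quasi_ordered_ring.primeideal_supp)

end
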